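(* Let $\epsilon>0$ and let $\{\omega_n\}_{n=1}^\infty$ be an increasing sequence of positive real numbers such that $\int_{\omega_n}^\infty \Xi(t)\,dt=0$ and $\omega_{n+1}-\omega_n<\omega_n^{\frac16+\epsilon}$ for all $n=1,2,\dots$. Then $$\int_{[\omega_n,\infty)^+}\Xi(t)\,dt=-\int_{[\omega_n,\infty)^-}\Xi(t)\,dt,\qquad n=1,2,\dots,$$ where $[\omega_n,\infty)^+=\{t\in[\omega_n,\infty):\ \Xi(t)>0\}$ and $[\omega_n,\infty)^-=\{t\in[\omega_n,\infty):\ \Xi(t)<0\}$.
   Context: Here $\Xi(z)=\xi\left(\frac12+iz\right)$, where $\xi(s)=\frac{s(s-1)}{2}\pi^{-s/2}\Gamma\left(\frac s2\right)\zeta(s)$, with $\zeta$ the Riemann zeta-function and $\Gamma$ the Gamma function. The function $\Xi(t)$ is real for real $t$. *)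

theory Defs
  imports "HOL-Complex_Analysis.Complex_Analysis"
begin

text \<open>
  The Riemann zeta-function as the analytic continuation of the Dirichlet series. Such a
  continuation exists, and by the identity theorem it is uniquely determined on
  the complement of \<open>{1}\<close>; only its (irrelevant) value at the pole \<open>1\<close> is left unspecified.
\<close>

definition is_zeta_continuation :: "(complex \<Rightarrow> complex) \<Rightarrow> bool" where
  "is_zeta_continuation f \<longleftrightarrow>
     f holomorphic_on - {1} \<and>
     (\<forall>s. Re s > 1 \<longrightarrow> f s = (\<Sum>n. of_nat (Suc n) powr (- s)))"

definition zeta :: "complex \<Rightarrow> complex" where
  "zeta = (SOME f. is_zeta_continuation f)"

text \<open>
  The product formula below has removable singularities at \<open>1, 0, -2, -4, \<dots>\<close>, where it does not
  return the value of the entire function \<open>\<xi>\<close> (Isabelle's \<open>Gamma\<close> is \<open>0\<close> at its poles). None of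
  these points lies on the critical line, the only place where \<open>\<xi>\<close> is evaluated when the
  argument of \<open>\<Xi>\<close> is real.
\<close>

definition riemann_xi :: "complex \<Rightarrow> complex" where
  "riemann_xi s =
     s * (s - 1) / 2 * of_real pi powr (- s / 2) * Gamma (s / 2) * zeta s"

definition riemann_Xi :: "complex \<Rightarrow> complex" where
  "riemann_Xi z = riemann_xi (1 / 2 + \<i> * z)"

text \<open>
  \<open>\<Xi>(t)\<close> is real for real \<open>t\<close>, so taking the real part changes only the type.
\<close>

definition real_Xi :: "real \<Rightarrow> real" where
  "real_Xi t = Re (riemann_Xi (of_real t))"

end

theory Submission
  imports Defs
begin

text \<open>
  The integral over \<open>[\<omega>\<^sub>n, \<infinity>)\<close> is the sum of the integrals over the sets where \<open>\<Xi>\<close> is positive and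
  where it is negative. Since it vanishes, these two are opposite. The decomposition needs
  \<open>\<Xi>\<close> to be absolutely integrable on \<open>[a, \<infinity>)\<close> for \<open>a > 0\<close>, and all the work goes into that
  (\<open>set_integrable_real_Xi\<close>).
  
  Integrability follows from continuity together with \<open>\<Xi>(t) = O(t\<^sup>-\<^sup>2)\<close>. On the critical line
  \<open>zeta s = O(\<bar>s\<bar>)\<close>, while \<open>\<bar>Gamma z\<bar> \<le> Gamma (Re z + k) / \<bar>z\<bar>\<^sup>k\<close> for every \<open>k\<close>, by the functional
  equation of \<open>Gamma\<close> and the Euler integral; \<open>k = 5\<close> suffices.
  
  Both the existence of the zeta-function and its growth come from the first-order Euler-Maclaurin
  formula \<open>zeta s = 1 / (s - 1) + 1 / 2 - s T(s + 1)\<close>, where \<open>T\<close> is the Mellin transform over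
  \<open>[1, \<infinity>)\<close> of the sawtooth \<open>{x} - 1/2\<close>. It is bounded on every vertical line with \<open>Re s > 1\<close>, and
  it extends to an entire function: if \<open>g\<close> is periodic with mean zero and \<open>G\<close> is its periodic antiderivative with mean
  zero, then integration by parts gives \<open>T\<^sub>g(s) = - G(0) + s T\<^sub>G(s + 1)\<close>
  (\<open>periodic_mellin_by_parts\<close>), which moves the half-plane of definition one unit to the left and
  can be repeated for \<open>G\<close>.
\<close>

section \<open>Mellin transforms of periodic functions\<close>

text \<open>
  With \<open>{x}\<close> the fractional part, this is \<open>\<integral> g({x}) x\<^sup>-\<^sup>s dx\<close> over \<open>[n + 1, n + 2]\<close>. Only the values of \<open>g\<close> on the
  unit interval enter, so the periodic extension of \<open>g\<close>, which may jump at the integers, never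
  has to be formed.
\<close>

definition cell_integral :: "(real \<Rightarrow> real) \<Rightarrow> nat \<Rightarrow> complex \<Rightarrow> complex" where
  "cell_integral g n s =
     integral {0..1} (\<lambda>x. of_real (g x) * of_real (real n + 1 + x) powr (- s))"

text \<open>
  The integral \<open>\<integral> g({x}) x\<^sup>-\<^sup>s dx\<close> over \<open>[1, \<infinity>)\<close>, cut at the integers; it converges absolutely for
  \<open>Re s > 1\<close>.
\<close>

definition periodic_mellin :: "(real \<Rightarrow> real) \<Rightarrow> complex \<Rightarrow> complex" where
  "periodic_mellin g s = (\<Sum>n. cell_integral g n s)"

lemma continuous_on_cell_integrand:
  assumes "continuous_on {0..1} g"
  shows "continuous_on {0..1} (\<lambda>x. of_real (g x) * of_real (real n + 1 + x) powr (- s) :: complex)"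
  by (intro continuous_intros assms) (auto simp: complex_nonpos_Reals_iff complex_eq_iff)

text \<open>
  The exponent \<open>\<sigma>\<close> is kept apart from \<open>Re s\<close> so that one summable majorant serves all \<open>s\<close> in a closed
  half-plane, as the Weierstrass test requires.
\<close>

lemma norm_cell_integral_le:
  assumes g: "continuous_on {0..1} g" and B: "\<And>x. x \<in> {0..1} \<Longrightarrow> \<bar>g x\<bar> \<le> B"
    and \<sigma>: "0 \<le> \<sigma>" "\<sigma> \<le> Re s"
  shows "norm (cell_integral g n s) \<le> B * real (Suc n) powr (- \<sigma>)"
proof -
  have "norm (cell_integral g n s) \<le> integral {0..1} (\<lambda>x::real. B * real (Suc n) powr (- \<sigma>))"
    unfolding cell_integral_def
  proof (rule integral_norm_bound_integral)
    show "(\<lambda>x. of_real (g x) * of_real (real n + 1 + x) powr (- s) :: complex) integrable_on {0..1}"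
      by (intro integrable_continuous_interval continuous_on_cell_integrand g)
    fix x :: real assume x: "x \<in> {0..1}"
    have "norm (of_real (real n + 1 + x) powr (- s) :: complex) = (real n + 1 + x) powr (- Re s)"
      using x by (subst norm_powr_real_powr) auto
    also have "\<dots> \<le> (real n + 1 + x) powr (- \<sigma>)"
      using x \<sigma> by (intro powr_mono) auto
    also have "\<dots> \<le> real (Suc n) powr (- \<sigma>)"
      using x \<sigma> by (intro powr_mono2') auto
    finally show "norm (of_real (g x) * of_real (real n + 1 + x) powr (- s) :: complex)
        \<le> B * real (Suc n) powr (- \<sigma>)"
      using B[OF x] by (simp only: norm_mult norm_of_real) (intro mult_mono, auto)
  qed auto
  thus ?thesis by simp
qed

lemma holomorphic_cell_integral:
  assumes "continuous_on {0..1} g"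
  shows "cell_integral g n holomorphic_on UNIV"
proof -
  define b where "b = (\<lambda>x::real. complex_of_real (real n + 1 + x))"
  have nz: "b x \<noteq> 0" "b x \<notin> \<real>\<^sub>\<le>\<^sub>0" if "x \<in> {0..1}" for x
    using that by (auto simp: b_def complex_nonpos_Reals_iff complex_eq_iff)
  have contb: "continuous_on A b" for A
    unfolding b_def by (intro continuous_intros)
  have "(\<lambda>s. integral (cbox 0 1) (\<lambda>x. of_real (g x) * b x powr (- s))) holomorphic_on UNIV"
  proof (rule leibniz_rule_holomorphic)
    fix s :: complex and x :: real assume x: "x \<in> cbox 0 1"
    show "((\<lambda>s. of_real (g x) * b x powr (- s)) has_field_derivative
        (of_real (g x) * (- (Ln (b x) * b x powr (- s))))) (at s within UNIV)"
      using nz[of x] x by (auto intro!: derivative_eq_intros has_field_derivative_powr_right[THEN DERIV_chain2])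
  next
    fix s :: complex
    show "(\<lambda>x. of_real (g x) * b x powr (- s)) integrable_on cbox 0 1"
      using integrable_continuous_interval[OF continuous_on_cell_integrand[OF assms, of n s]]
      by (simp add: b_def)
  next
    show "continuous_on (UNIV \<times> cbox 0 1)
        (\<lambda>(s, x). of_real (g x) * (- (Ln (b x) * b x powr (- s))))"
      unfolding split_beta
      by (intro continuous_intros continuous_on_compose2[OF assms] continuous_on_compose2[OF contb[of UNIV]])
         (auto simp: b_def complex_nonpos_Reals_iff complex_eq_iff)
  qed auto
  thus ?thesis by (simp add: cell_integral_def[abs_def] b_def)
qed

lemma summable_real_Suc_powr: "\<sigma> > 1 \<Longrightarrow> summable (\<lambda>n. real (Suc n) powr (- \<sigma>))"
  using summable_real_powr_iff[of "-\<sigma>"] summable_Suc_iff[of "\<lambda>n. real n powr (-\<sigma>)"] by simp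

lemma continuous_unit_interval_bound:
  assumes "continuous_on {0..1::real} (g :: real \<Rightarrow> real)"
  obtains B where "\<And>x. x \<in> {0..1} \<Longrightarrow> \<bar>g x\<bar> \<le> B"
proof -
  have "bounded (g ` {0..1})"
    by (intro compact_imp_bounded compact_continuous_image assms) auto
  then obtain B where "\<forall>y\<in>g ` {0..1}. norm y \<le> B" unfolding bounded_iff by blast
  thus ?thesis by (intro that[of B]) simp
qed

lemma summable_cell_integral:
  assumes "continuous_on {0..1} g" "Re s > 1"
  shows "summable (\<lambda>n. cell_integral g n s)"
proof -
  obtain B where B: "\<And>x. x \<in> {0..1} \<Longrightarrow> \<bar>g x\<bar> \<le> B"
    using continuous_unit_interval_bound[OF assms(1)] by blast
  show ?thesis
  proof (rule summable_comparison_test')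
    show "summable (\<lambda>n. B * real (Suc n) powr (- Re s))"
      by (intro summable_mult summable_real_Suc_powr assms)
    show "norm (cell_integral g n s) \<le> B * real (Suc n) powr (- Re s)" if "n \<ge> 0" for n
      using assms by (intro norm_cell_integral_le B) auto
  qed
qed

lemma periodic_mellin_bounded:
  assumes "continuous_on {0..1} g" "\<sigma> > 1"
  obtains K where "\<And>s. Re s = \<sigma> \<Longrightarrow> norm (periodic_mellin g s) \<le> K"
proof -
  obtain B where B: "\<And>x. x \<in> {0..1} \<Longrightarrow> \<bar>g x\<bar> \<le> B"
    using continuous_unit_interval_bound[OF assms(1)] by blast
  have "norm (periodic_mellin g s) \<le> (\<Sum>n. B * real (Suc n) powr (- \<sigma>))" if "Re s = \<sigma>" for s
    unfolding periodic_mellin_def using assms that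
    by (intro norm_suminf_le norm_cell_integral_le B summable_mult summable_real_Suc_powr) auto
  thus ?thesis using that by blast
qed

lemma holomorphic_periodic_mellin:
  assumes g: "continuous_on {0..1} g"
  shows "periodic_mellin g holomorphic_on {s. Re s > 1}"
proof (rule holomorphic_uniform_sequence)
  show "open {s. Re s > 1}" by (rule open_halfspace_Re_gt)
  show "(\<lambda>s. \<Sum>k<n. cell_integral g k s) holomorphic_on {s. Re s > 1}" for n
    by (intro holomorphic_intros holomorphic_on_subset[OF holomorphic_cell_integral[OF g]]) auto
  fix z :: complex assume z: "z \<in> {s. Re s > 1}"
  obtain B where B: "\<And>x. x \<in> {0..1} \<Longrightarrow> \<bar>g x\<bar> \<le> B"
    using continuous_unit_interval_bound[OF g] by blast
  define d where "d = (Re z - 1) / 2"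
  have d: "d > 0" using z by (simp add: d_def)
  have Re_ge: "1 + d \<le> Re s" if "s \<in> cball z d" for s
    using that abs_Re_le_cmod[of "z - s"] by (simp add: dist_norm d_def field_simps abs_le_iff)
  have "uniform_limit (cball z d) (\<lambda>n s. \<Sum>k<n. cell_integral g k s) (periodic_mellin g) sequentially"
    unfolding periodic_mellin_def[abs_def]
  proof (rule Weierstrass_m_test)
    show "summable (\<lambda>n. B * real (Suc n) powr (- (1 + d)))"
      using d by (intro summable_mult summable_real_Suc_powr) auto
    show "norm (cell_integral g n s) \<le> B * real (Suc n) powr (- (1 + d))" if "s \<in> cball z d" for n s
      using d Re_ge[OF that] by (intro norm_cell_integral_le g B) auto
  qed
  moreover have "cball z d \<subseteq> {s. Re s > 1}"
    using Re_ge d by fastforce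
  ultimately show "\<exists>d>0. cball z d \<subseteq> {s. Re s > 1} \<and>
      uniform_limit (cball z d) (\<lambda>n s. \<Sum>k<n. cell_integral g k s) (periodic_mellin g) sequentially"
    using d by blast
qed

lemma has_vector_derivative_shifted_powr:
  assumes "x \<ge> 0"
  shows "((\<lambda>x. of_real (real n + 1 + x) powr (- s) :: complex) has_vector_derivative
           (- s * of_real (real n + 1 + x) powr (- (s + 1)))) (at x within A)"
proof -
  have "((\<lambda>z. z powr (- s)) has_field_derivative
          (- s * of_real (real n + 1 + x) powr (- s - 1))) (at (of_real (real n + 1 + x)))"
    by (rule has_field_derivative_powr) (use assms in \<open>auto simp: complex_nonpos_Reals_iff\<close>)
  note outer = has_field_derivative_at_within[OF this]
  have "((\<lambda>x. complex_of_real (real n + 1 + x)) has_vector_derivative 1) (at x within A)"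
    by (auto intro!: derivative_eq_intros)
  from field_vector_diff_chain_within[OF this outer]
  show ?thesis by (simp add: o_def minus_diff_commute)
qed

text \<open>
  The boundary terms at the two ends of a cell are kept separate: they telescope over \<open>n\<close> when
  \<open>G 0 = G 1\<close>, and they produce the terms of the Dirichlet series when \<open>G 0 \<noteq> G 1\<close>.
\<close>

lemma cell_integral_by_parts:
  assumes g: "continuous_on {0..1} g"
    and G: "\<And>x. x \<in> {0..1} \<Longrightarrow> (G has_real_derivative g x) (at x within {0..1})"
  shows "cell_integral g n s =
    of_real (G 1) * of_nat (n + 2) powr (- s) - of_real (G 0) * of_nat (n + 1) powr (- s)
      + s * cell_integral G n (s + 1)"
proof -
  define p where "p = (\<lambda>s x. complex_of_real (real n + 1 + x) powr (- s))"
  have contG: "continuous_on {0..1} G"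
    using G by (rule DERIV_continuous_on)
  have ftc: "((\<lambda>x. of_real (g x) * p s x + of_real (G x) * (- s * p (s + 1) x)) has_integral
         (of_real (G 1) * p s 1 - of_real (G 0) * p s 0)) {0..1}"
  proof (rule fundamental_theorem_of_calculus)
    fix x :: real assume x: "x \<in> {0..1}"
    have "(p s has_vector_derivative (- s * p (s + 1) x)) (at x within {0..1})"
      unfolding p_def by (rule has_vector_derivative_shifted_powr) (use x in auto)
    moreover have "((\<lambda>x. complex_of_real (G x)) has_vector_derivative of_real (g x)) (at x within {0..1})"
      using G[OF x] by (intro has_vector_derivative_of_real)
        (simp add: has_real_derivative_iff_has_vector_derivative)
    ultimately show "((\<lambda>x. of_real (G x) * p s x) has_vector_derivative
        of_real (g x) * p s x + of_real (G x) * (- s * p (s + 1) x)) (at x within {0..1})"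
      using has_vector_derivative_mult by (fastforce simp: add.commute)
  qed auto
  have int_g: "((\<lambda>x. of_real (g x) * p s x) has_integral cell_integral g n s) {0..1}"
    unfolding p_def cell_integral_def
    by (intro integrable_integral integrable_continuous_interval continuous_on_cell_integrand g)
  have "((\<lambda>x. of_real (G x) * p (s + 1) x) has_integral cell_integral G n (s + 1)) {0..1}"
    unfolding p_def cell_integral_def
    by (intro integrable_integral integrable_continuous_interval continuous_on_cell_integrand contG)
  from has_integral_mult_right[OF this, of "- s"]
  have int_G: "((\<lambda>x. of_real (G x) * (- s * p (s + 1) x)) has_integral (- s * cell_integral G n (s + 1))) {0..1}"
    by (simp add: algebra_simps)
  have "of_real (G 1) * p s 1 - of_real (G 0) * p s 0 =
      cell_integral g n s + (- s * cell_integral G n (s + 1))"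
    by (rule has_integral_unique[OF ftc has_integral_add[OF int_g int_G]])
  thus ?thesis by (simp add: p_def algebra_simps)
qed

lemma Suc_powr_tendsto_0:
  assumes "Re s > 0"
  shows "(\<lambda>n. of_nat (Suc n) powr (- s) :: complex) \<longlonglongrightarrow> 0"
proof (rule tendsto_norm_zero_cancel)
  have "(\<lambda>n. real (Suc n) powr (- Re s)) \<longlonglongrightarrow> 0"
    using assms by (intro tendsto_neg_powr filterlim_compose[OF filterlim_real_sequentially filterlim_Suc]) auto
  thus "(\<lambda>n. norm (of_nat (Suc n) powr (- s) :: complex)) \<longlonglongrightarrow> 0"
    by (subst norm_powr_real_powr) auto
qed

section \<open>Continuation of the Mellin transform to the whole plane\<close>

text \<open>
  The engine of the continuation: the right-hand side evaluates a transform at \<open>s + 1\<close>, so it makes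
  sense on a half-plane that reaches one unit further to the left.
\<close>

lemma periodic_mellin_by_parts:
  assumes g: "continuous_on {0..1} g"
    and G: "\<And>x. x \<in> {0..1} \<Longrightarrow> (G has_real_derivative g x) (at x within {0..1})"
    and eq: "G 0 = G 1" and s: "Re s > 1"
  shows "periodic_mellin g s = - of_real (G 0) + s * periodic_mellin G (s + 1)"
proof -
  have contG: "continuous_on {0..1} G"
    using G by (rule DERIV_continuous_on)
  have "(\<lambda>n. of_nat (Suc (Suc n)) powr (- s) - of_nat (Suc n) powr (- s)) sums
          (0 - of_nat (Suc 0) powr (- s) :: complex)"
    by (rule telescope_sums[OF Suc_powr_tendsto_0]) (use s in auto)
  from sums_mult[OF this, of "of_real (G 0)"]
  have "(\<lambda>n. of_real (G 0) * (of_nat (Suc (Suc n)) powr (- s) - of_nat (Suc n) powr (- s))) sums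
          (- of_real (G 0) :: complex)" by simp
  moreover have "(\<lambda>n. s * cell_integral G n (s + 1)) sums (s * periodic_mellin G (s + 1))"
    unfolding periodic_mellin_def
    by (intro sums_mult summable_sums summable_cell_integral contG) (use s in auto)
  ultimately have "(\<lambda>n. of_real (G 0) * (of_nat (Suc (Suc n)) powr (- s) - of_nat (Suc n) powr (- s))
       + s * cell_integral G n (s + 1)) sums (- of_real (G 0) + s * periodic_mellin G (s + 1))"
    by (rule sums_add)
  also have "(\<lambda>n. of_real (G 0) * (of_nat (Suc (Suc n)) powr (- s) - of_nat (Suc n) powr (- s))
       + s * cell_integral G n (s + 1)) = (\<lambda>n. cell_integral g n s)"
    by (subst cell_integral_by_parts[OF g G]) (auto simp: eq algebra_simps)
  finally show ?thesis by (simp add: periodic_mellin_def sums_iff)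
qed

text \<open>
  Mean zero of \<open>g\<close> makes every antiderivative periodic, and the constant of integration is free
  to restore mean zero, so that the step can be iterated.
\<close>

lemma mean_zero_antiderivative:
  assumes g: "continuous_on {0..1::real} (g :: real \<Rightarrow> real)" and mean: "integral {0..1} g = 0"
  obtains G where "\<And>x. x \<in> {0..1} \<Longrightarrow> (G has_real_derivative g x) (at x within {0..1})"
    "G 0 = G 1" "continuous_on {0..1} G" "integral {0..1} G = 0"
proof -
  define H where "H = (\<lambda>x. integral {0..x} g)"
  define G where "G = (\<lambda>x. H x - integral {0..1} H)"
  have H: "(H has_real_derivative g x) (at x within {0..1})" if "x \<in> {0..1}" for x
    unfolding H_def has_real_derivative_iff_has_vector_derivative
    by (rule integral_has_vector_derivative[OF g that])
  hence contH: "continuous_on {0..1} H" by (rule DERIV_continuous_on)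
  show ?thesis
  proof
    show "(G has_real_derivative g x) (at x within {0..1})" if "x \<in> {0..1}" for x
      unfolding G_def using H[OF that] by (auto intro!: derivative_eq_intros)
    show "G 0 = G 1" using mean by (simp add: G_def H_def)
    show "continuous_on {0..1} G" unfolding G_def by (intro continuous_intros contH)
    have "integral {0..1} G = integral {0..1} H - integral {0..1::real} (\<lambda>x. integral {0..1} H)"
      unfolding G_def
      by (rule integral_diff) (auto intro: integrable_continuous_interval contH)
    thus "integral {0..1} G = 0" by simp
  qed
qed

lemma periodic_mellin_extends_to_halfplane:
  assumes "continuous_on {0..1} g" "integral {0..1} g = 0"
  shows "\<exists>f. f holomorphic_on {s. Re s > 1 - real N} \<and> (\<forall>s. Re s > 1 \<longrightarrow> f s = periodic_mellin g s)"
  using assms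
proof (induction N arbitrary: g)
  case 0
  thus ?case using holomorphic_periodic_mellin[of g] by auto
next
  case (Suc N)
  obtain G where G: "\<And>x. x \<in> {0..1} \<Longrightarrow> (G has_real_derivative g x) (at x within {0..1})"
    "G 0 = G 1" "continuous_on {0..1} G" "integral {0..1} G = 0"
    using mean_zero_antiderivative[OF Suc.prems] by blast
  obtain f where f: "f holomorphic_on {s. Re s > 1 - real N}"
    "\<And>s. Re s > 1 \<Longrightarrow> f s = periodic_mellin G s"
    using Suc.IH[OF G(3,4)] by blast
  have "(\<lambda>s. - of_real (G 0) + s * f (s + 1)) holomorphic_on {s. Re s > 1 - real (Suc N)}"
    by (intro holomorphic_intros holomorphic_on_compose_gen[OF _ f(1), unfolded o_def]) auto
  moreover have "- of_real (G 0) + s * f (s + 1) = periodic_mellin g s" if "Re s > 1" for s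
    using periodic_mellin_by_parts[OF Suc.prems(1) G(1,2) that] f(2)[of "s + 1"] that by simp
  ultimately show ?case by blast
qed

text \<open>
  The extensions to different half-planes agree on the smaller one because they agree on
  \<open>Re s > 1\<close>, hence they glue to an entire function.
\<close>

lemma periodic_mellin_extends_to_entire:
  assumes "continuous_on {0..1} g" "integral {0..1} g = 0"
  obtains F where "F holomorphic_on UNIV" "\<And>s. Re s > 1 \<Longrightarrow> F s = periodic_mellin g s"
proof -
  define H where "H = (\<lambda>N. {s. Re s > 1 - real N})"
  have "\<forall>N. \<exists>f. f holomorphic_on H N \<and> (\<forall>s. Re s > 1 \<longrightarrow> f s = periodic_mellin g s)"
    unfolding H_def using periodic_mellin_extends_to_halfplane[OF assms] by blast
  then obtain f where f: "\<And>N. f N holomorphic_on H N"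
    "\<And>N s. Re s > 1 \<Longrightarrow> f N s = periodic_mellin g s" by metis
  have openH: "open (H N)" for N unfolding H_def by (rule open_halfspace_Re_gt)
  have coherent: "f M s = f N s" if "M \<le> N" "s \<in> H M" for M N s
  proof (rule analytic_continuation_open[of "{s. Re s > 1}" "H M" "f M" "f N"])
    have "H M \<subseteq> H N" using that by (auto simp: H_def)
    thus "f N holomorphic_on H M" using f(1) holomorphic_on_subset by blast
    show "{s. Re s > 1} \<noteq> {}" by (auto intro: exI[of _ 2])
    show "connected (H M)" unfolding H_def
      by (intro convex_connected convex_halfspace_Re_gt)
  qed (use that openH f in \<open>auto simp: open_halfspace_Re_gt H_def\<close>)
  (* any index N with Re s > 1 - N would do; this choice satisfies N \<ge> 2 - Re s *)
  define F where "F = (\<lambda>s. f (nat \<lceil>2 - Re s\<rceil>) s)"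
  have F_eq: "F s = f N s" if "s \<in> H N" for N s
  proof -
    have "s \<in> H (nat \<lceil>2 - Re s\<rceil>)" unfolding H_def by simp linarith
    thus ?thesis unfolding F_def using that coherent[of _ _ s] by (metis nle_le)
  qed
  have "F holomorphic_on (\<Union>N. H N)"
  proof (rule holomorphic_on_UN_open)
    show "F holomorphic_on H N" for N
      using f(1)[of N] F_eq by (metis holomorphic_transform)
  qed (use openH in auto)
  moreover have "(\<Union>N. H N) = UNIV"
  proof -
    have "s \<in> H (nat \<lceil>2 - Re s\<rceil>)" for s unfolding H_def by simp linarith
    thus ?thesis by blast
  qed
  moreover have "F s = periodic_mellin g s" if "Re s > 1" for s
    using F_eq[of s 0] f(2)[OF that] that by (simp add: H_def)
  ultimately show ?thesis using that by simp
qed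

section \<open>The zeta-function\<close>

text \<open>
  On the unit interval this is the first Bernoulli polynomial, the antiderivative of \<open>1\<close> with mean
  zero.
\<close>

abbreviation sawtooth :: "real \<Rightarrow> real" where
  "sawtooth \<equiv> (\<lambda>x. x - 1/2)"

lemma continuous_on_sawtooth: "continuous_on {0..1} sawtooth"
  by (intro continuous_intros)

lemma integral_sawtooth: "integral {0..1} sawtooth = 0"
proof -
  have "(sawtooth has_integral ((1\<^sup>2 - 1) / 2 - (0\<^sup>2 - 0) / 2)) {0..1}"
    by (rule fundamental_theorem_of_calculus)
       (auto intro!: derivative_eq_intros simp flip: has_real_derivative_iff_has_vector_derivative)
  thus ?thesis by (simp add: integral_unique)
qed

text \<open>
  This is \<open>\<integral> x\<^sup>-\<^sup>s dx = 1 / (s - 1)\<close> over \<open>[1, \<infinity>)\<close>.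
\<close>

lemma cell_integral_one_sums:
  assumes s: "Re s > 1"
  shows "(\<lambda>n. cell_integral (\<lambda>_. 1) n s) sums (1 / (s - 1))"
proof -
  have "cell_integral (\<lambda>_. 1) n s =
      (of_nat (Suc n) powr (- (s - 1)) - of_nat (Suc (Suc n)) powr (- (s - 1))) / (s - 1)" for n
  proof -
    (* integration by parts with the constant G = 1, read backwards, evaluates the cell integral *)
    have "cell_integral (\<lambda>_. 0) n (s - 1) = of_real 1 * of_nat (n + 2) powr (- (s - 1))
        - of_real 1 * of_nat (n + 1) powr (- (s - 1)) + (s - 1) * cell_integral (\<lambda>_. 1) n (s - 1 + 1)"
      by (rule cell_integral_by_parts[where G = "\<lambda>_. 1"]) auto
    moreover have "cell_integral (\<lambda>_. 0) n (s - 1) = 0"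
      by (simp add: cell_integral_def)
    moreover have "s - 1 \<noteq> 0" using s by auto
    ultimately show ?thesis by (simp add: field_simps)
  qed
  moreover have "(\<lambda>n. (of_nat (Suc n) powr (- (s - 1)) - of_nat (Suc (Suc n)) powr (- (s - 1))) / (s - 1))
      sums ((of_nat (Suc 0) powr (- (s - 1)) - 0) / (s - 1))"
    using s by (intro sums_divide telescope_sums' Suc_powr_tendsto_0) auto
  ultimately show ?thesis by simp
qed

lemma summable_dirichlet_series:
  assumes "Re s > 1"
  shows "summable (\<lambda>n. of_nat (Suc n) powr (- s) :: complex)"
proof (rule summable_norm_cancel)
  have "norm (of_nat (Suc n) powr (- s) :: complex) = real (Suc n) powr (- Re s)" for n
    by (subst norm_powr_real_powr) auto
  thus "summable (\<lambda>n. norm (of_nat (Suc n) powr (- s) :: complex))"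
    using summable_real_Suc_powr[OF assms] by presburger
qed

text \<open>
  The Euler-Maclaurin formula of first order: integration by parts of \<open>1 \<cdot> x\<^sup>-\<^sup>s\<close> against the sawtooth gives
  half of the Dirichlet term at each end of a cell, so summation counts every term once except
  the first, which is counted half.
\<close>

lemma dirichlet_series_eq:
  assumes s: "Re s > 1"
  shows "(\<Sum>n. of_nat (Suc n) powr (- s)) =
           1 / (s - 1) + 1 / 2 - s * periodic_mellin sawtooth (s + 1)"
proof -
  define Z where "Z = (\<Sum>n. of_nat (Suc n) powr (- s))"
  have Z: "(\<lambda>n. of_nat (Suc n) powr (- s)) sums Z"
    unfolding Z_def by (rule summable_sums[OF summable_dirichlet_series[OF s]])
  hence Z': "(\<lambda>n. of_nat (Suc (Suc n)) powr (- s)) sums (Z - 1)"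
    using sums_Suc_iff[of "\<lambda>n. of_nat (Suc n) powr (- s)" "Z - 1"] by simp
  have T: "(\<lambda>n. s * cell_integral sawtooth n (s + 1)) sums (s * periodic_mellin sawtooth (s + 1))"
    unfolding periodic_mellin_def
    by (intro sums_mult summable_sums summable_cell_integral continuous_on_sawtooth) (use s in auto)
  have "(\<lambda>n. 1 / 2 * of_nat (Suc (Suc n)) powr (- s) + 1 / 2 * of_nat (Suc n) powr (- s)
          + s * cell_integral sawtooth n (s + 1)) sums
        (1 / 2 * (Z - 1) + 1 / 2 * Z + s * periodic_mellin sawtooth (s + 1))"
    by (intro sums_add sums_mult Z Z' T)
  moreover have "cell_integral (\<lambda>_. 1) n s =
      1 / 2 * of_nat (Suc (Suc n)) powr (- s) + 1 / 2 * of_nat (Suc n) powr (- s)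
        + s * cell_integral sawtooth n (s + 1)" for n
    by (subst cell_integral_by_parts[where G = sawtooth])
       (auto intro!: derivative_eq_intros)
  ultimately have "1 / (s - 1) = 1 / 2 * (Z - 1) + 1 / 2 * Z + s * periodic_mellin sawtooth (s + 1)"
    using cell_integral_one_sums[OF s] by (simp add: sums_iff)
  thus ?thesis unfolding Z_def[symmetric] by (simp add: field_simps)
qed

text \<open>
  \<open>zeta\<close> is chosen among the continuations of the Dirichlet series, so nothing is known about it
  until one continuation to the whole punctured plane is exhibited.
\<close>

lemma is_zeta_continuation_zeta: "is_zeta_continuation zeta"
proof -
  obtain F where F: "F holomorphic_on UNIV" "\<And>s. Re s > 1 \<Longrightarrow> F s = periodic_mellin sawtooth s"
    using periodic_mellin_extends_to_entire[OF continuous_on_sawtooth integral_sawtooth] by blast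
  have "is_zeta_continuation (\<lambda>s. 1 / (s - 1) + 1 / 2 - s * F (s + 1))"
    unfolding is_zeta_continuation_def
  proof (intro conjI allI impI)
    show "(\<lambda>s. 1 / (s - 1) + 1 / 2 - s * F (s + 1)) holomorphic_on - {1}"
      by (intro holomorphic_intros holomorphic_on_compose_gen[OF _ F(1), unfolded o_def]) auto
  next
    fix s :: complex assume "Re s > 1"
    thus "1 / (s - 1) + 1 / 2 - s * F (s + 1) = (\<Sum>n. of_nat (Suc n) powr (- s))"
      using dirichlet_series_eq[of s] F(2)[of "s + 1"] by simp
  qed
  thus ?thesis unfolding zeta_def by (rule someI[where P = is_zeta_continuation])
qed

text \<open>
  For \<open>Re s > 0\<close> the argument \<open>s + 1\<close> lies in the half-plane of absolute convergence, so here the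
  Euler-Maclaurin remainder is the convergent series itself and can be estimated.
\<close>

lemma zeta_eq:
  assumes "Re s > 0" "s \<noteq> 1"
  shows "zeta s = 1 / (s - 1) + 1 / 2 - s * periodic_mellin sawtooth (s + 1)"
proof (rule analytic_continuation_open[of "{s. Re s > 1}" "{s. Re s > 0} - {1}" zeta
      "\<lambda>s. 1 / (s - 1) + 1 / 2 - s * periodic_mellin sawtooth (s + 1)" s])
  show "zeta holomorphic_on {s. Re s > 0} - {1}"
    using is_zeta_continuation_zeta unfolding is_zeta_continuation_def
    by (auto intro: holomorphic_on_subset)
  show "(\<lambda>s. 1 / (s - 1) + 1 / 2 - s * periodic_mellin sawtooth (s + 1)) holomorphic_on {s. Re s > 0} - {1}"
    by (intro holomorphic_intros holomorphic_on_compose_gen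
          [OF _ holomorphic_periodic_mellin[OF continuous_on_sawtooth], unfolded o_def]) auto
  show "zeta s = 1 / (s - 1) + 1 / 2 - s * periodic_mellin sawtooth (s + 1)" if "s \<in> {s. Re s > 1}" for s
    using is_zeta_continuation_zeta dirichlet_series_eq[of s] that
    by (simp add: is_zeta_continuation_def)
  show "connected ({s. Re s > 0} - {1})"
    by (intro connected_open_delete open_halfspace_Re_gt convex_connected convex_halfspace_Re_gt) auto
  show "{s. Re s > 1} \<noteq> {}" by (auto intro: exI[of _ 2])
qed (use assms in \<open>auto intro: open_halfspace_Re_gt\<close>)

section \<open>Decay on the critical line\<close>

lemma norm_ge_half_of_critical_line: "Re s = 1 / 2 \<Longrightarrow> 1 / 2 \<le> norm s"
  using abs_Re_le_cmod[of s] by simp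

lemma norm_minus_one_of_critical_line:
  assumes "Re s = 1 / 2"
  shows "norm (s - 1) = norm s"
  unfolding cmod_def minus_complex.sel assms by (simp add: power2_eq_square)

text \<open>
  The transform of the sawtooth is evaluated on the line \<open>Re = 3/2\<close>, where it is bounded, and it
  is multiplied by \<open>s\<close>.
\<close>

lemma zeta_critical_line_bound:
  obtains C where "C \<ge> 0" "\<And>s. Re s = 1 / 2 \<Longrightarrow> norm (zeta s) \<le> C * norm s"
proof -
  obtain K where K: "\<And>s. Re s = 3 / 2 \<Longrightarrow> norm (periodic_mellin sawtooth s) \<le> K"
    using periodic_mellin_bounded[OF continuous_on_sawtooth, of "3 / 2"] by auto
  have K0: "0 \<le> K" by (rule order_trans[OF norm_ge_zero K[of "3 / 2"]]) simp
  have "norm (zeta s) \<le> (5 + K) * norm s" if s: "Re s = 1 / 2" for s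
  proof -
    have ge: "1 / 2 \<le> norm s" by (rule norm_ge_half_of_critical_line[OF s])
    have eq: "zeta s = 1 / (s - 1) + 1 / 2 - s * periodic_mellin sawtooth (s + 1)"
      by (rule zeta_eq) (use s in auto)
    have "norm (zeta s) \<le> norm (1 / (s - 1)) + norm (1 / 2 :: complex)
        + norm (s * periodic_mellin sawtooth (s + 1))"
      unfolding eq by (intro norm_triangle_le_diff add_right_mono norm_triangle_ineq)
    also have "norm (1 / (s - 1)) \<le> 4 * norm s"
    proof -
      have "1 \<le> 4 * norm s * norm s" using mult_mono[OF ge ge] by simp
      moreover have "norm s > 0" using ge by linarith
      ultimately show ?thesis
        by (simp add: norm_divide norm_minus_one_of_critical_line[OF s] field_simps)
    qed
    also have "norm (1 / 2 :: complex) \<le> norm s" using ge by (simp add: norm_divide)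
    also have "norm (s * periodic_mellin sawtooth (s + 1)) \<le> norm s * K"
      unfolding norm_mult by (intro mult_left_mono K) (use s in auto)
    finally show ?thesis by (simp add: algebra_simps)
  qed
  thus ?thesis using that[of "5 + K"] K0 by simp
qed

text \<open>
  The absolute value is taken under the Euler integral.
\<close>

lemma norm_Gamma_le_Gamma_Re:
  assumes "Re z > 0"
  shows "norm (Gamma z) \<le> Gamma (Re z)"
proof -
  note Gz = Gamma_integral_complex[OF assms] and GR = Gamma_integral_real[OF assms]
  have "norm (integral {0..} (\<lambda>t. of_real t powr (z - 1) / of_real (exp t)))
      \<le> integral {0..} (\<lambda>t. t powr (Re z - 1) / exp t)"
  proof (rule integral_norm_bound_integral)
    fix t :: real assume "t \<in> {0..}"
    thus "norm (of_real t powr (z - 1) / of_real (exp t) :: complex) \<le> t powr (Re z - 1) / exp t"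
      by (simp add: norm_divide norm_powr_real_powr)
  qed (use Gz GR in \<open>auto simp: integrable_on_def\<close>)
  thus ?thesis using Gz GR by (simp add: integral_unique)
qed

text \<open>
  Shifting the argument by \<open>k\<close> divides out \<open>k\<close> factors \<open>z + i\<close>, each of modulus at
  least \<open>\<bar>z\<bar>\<close> because \<open>Re z > 0\<close>. So on a vertical line \<open>Gamma\<close> decays faster than every power.
\<close>

lemma norm_Gamma_power_le:
  assumes z: "Re z > 0"
  shows "norm (Gamma z) * norm z ^ k \<le> Gamma (Re z + real k)"
proof -
  have nz: "z \<notin> \<int>\<^sub>\<le>\<^sub>0" using z by (auto elim!: nonpos_Ints_cases)
  have "norm z ^ k \<le> norm (pochhammer z k)"
  proof -
    have "norm z \<le> norm (z + of_nat i)" for i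
      unfolding cmod_def by (intro real_sqrt_le_mono add_mono) (use z in \<open>auto intro: power_mono\<close>)
    hence "(\<Prod>i<k. norm z) \<le> (\<Prod>i<k. norm (z + of_nat i))"
      by (intro prod_mono) auto
    thus ?thesis by (simp add: pochhammer_prod prod_norm lessThan_atLeast0)
  qed
  hence "norm (Gamma z) * norm z ^ k \<le> norm (Gamma z) * norm (pochhammer z k)"
    by (intro mult_left_mono) auto
  also have "\<dots> = norm (Gamma (z + of_nat k))"
    using nz by (simp add: pochhammer_Gamma Gamma_eq_zero_iff norm_divide)
  also have "\<dots> \<le> Gamma (Re (z + of_nat k))"
    by (rule norm_Gamma_le_Gamma_Re) (use z in auto)
  finally show ?thesis by simp
qed

text \<open>
  The power count: \<open>s (s - 1)\<close> contributes \<open>\<bar>s\<bar>\<^sup>2\<close> and zeta at most \<open>\<bar>s\<bar>\<close>, so five powers gained from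
  \<open>Gamma\<close> leave a decay of order \<open>\<bar>s\<bar>\<^sup>-\<^sup>2\<close>, which is integrable.
\<close>

lemma riemann_xi_critical_line_bound:
  obtains C where "C \<ge> 0" "\<And>s. Re s = 1 / 2 \<Longrightarrow> norm (riemann_xi s) * norm s ^ 2 \<le> C"
proof -
  obtain C where C: "C \<ge> 0" "\<And>s. Re s = 1 / 2 \<Longrightarrow> norm (zeta s) \<le> C * norm s"
    using zeta_critical_line_bound by blast
  define D where "D = pi powr (- 1 / 4) * 16 * C * Gamma (1 / 4 + 5)"
  have "norm (riemann_xi s) * norm s ^ 2 \<le> D" if s: "Re s = 1 / 2" for s
  proof -
    define y where "y = norm s"
    have Gamma5: "norm (Gamma (s / 2)) * (y / 2) ^ 5 \<le> Gamma (1 / 4 + 5)"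
      using norm_Gamma_power_le[of "s / 2" 5] s by (simp add: y_def norm_divide)
    have "norm (of_real pi powr (- s / 2) :: complex) = pi powr (Re (- s / 2))"
      by (subst norm_powr_real_powr) auto
    also have "Re (- s / 2) = - 1 / 4" using s by simp
    finally have "norm (riemann_xi s) = y * y / 2 * pi powr (- 1 / 4) * norm (Gamma (s / 2)) * norm (zeta s)"
      by (simp add: riemann_xi_def norm_mult norm_divide y_def norm_minus_one_of_critical_line[OF s])
    also have "\<dots> * y ^ 2 \<le> y * y / 2 * pi powr (- 1 / 4) * norm (Gamma (s / 2)) * (C * y) * y ^ 2"
      unfolding y_def by (intro mult_right_mono mult_left_mono C s) auto
    also have "\<dots> = pi powr (- 1 / 4) * 16 * C * (norm (Gamma (s / 2)) * (y / 2) ^ 5)"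
      by (simp add: field_simps eval_nat_numeral)
    also have "\<dots> \<le> D"
      unfolding D_def using C(1) by (intro mult_left_mono Gamma5) auto
    finally show ?thesis by (simp add: y_def)
  qed
  moreover have "D \<ge> 0" unfolding D_def using C(1) by (simp add: Gamma_real_nonneg)
  ultimately show ?thesis using that by blast
qed

section \<open>Integrability and the sign decomposition\<close>

lemma continuous_on_real_Xi: "continuous_on UNIV real_Xi"
proof -
  define l where "l = (\<lambda>t::real. 1 / 2 + \<i> * complex_of_real t)"
  have cl: "continuous_on UNIV l" unfolding l_def by (intro continuous_intros)
  have "continuous_on (- {1}) zeta"
    using is_zeta_continuation_zeta
    by (simp add: is_zeta_continuation_def holomorphic_on_imp_continuous_on)
  hence cz: "continuous_on UNIV (\<lambda>t. zeta (l t))"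
    by (rule continuous_on_compose2[OF _ cl]) (auto simp: l_def complex_eq_iff)
  have "l t / 2 \<notin> \<int>\<^sub>\<le>\<^sub>0" for t
    by (auto simp: l_def complex_eq_iff elim!: nonpos_Ints_cases)
  hence cG: "continuous_on UNIV (\<lambda>t. Gamma (l t / 2))"
    by (intro continuous_on_compose2[OF continuous_on_Gamma[of "- \<int>\<^sub>\<le>\<^sub>0"]] continuous_intros cl) auto
  have "continuous_on UNIV (\<lambda>t. Re (l t * (l t - 1) / 2 * of_real pi powr (- l t / 2)
      * Gamma (l t / 2) * zeta (l t)))"
    by (intro continuous_intros cl cz cG) (auto simp: complex_nonpos_Reals_iff)
  thus ?thesis
    by (simp add: real_Xi_def[abs_def] riemann_Xi_def riemann_xi_def l_def)
qed

lemma set_integrable_real_Xi: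
  assumes a: "a > 0"
  shows "set_integrable lborel {a..} real_Xi"
proof -
  obtain C where C: "C \<ge> 0" "\<And>s. Re s = 1 / 2 \<Longrightarrow> norm (riemann_xi s) * norm s ^ 2 \<le> C"
    using riemann_xi_critical_line_bound by blast
  have bound: "norm (real_Xi t) \<le> norm (C * t powr (- 2))" if "t \<in> {a..}" for t
  proof -
    define s where "s = 1 / 2 + \<i> * complex_of_real t"
    have t: "t > 0" using that a by simp
    have "t \<le> norm s" using abs_Im_le_cmod[of s] by (simp add: s_def)
    hence "\<bar>real_Xi t\<bar> * t ^ 2 \<le> norm (riemann_xi s) * norm s ^ 2"
      unfolding real_Xi_def riemann_Xi_def s_def[symmetric] using t
      by (intro mult_mono power_mono abs_Re_le_cmod) auto
    also have "\<dots> \<le> C" by (rule C) (simp add: s_def)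
    finally show ?thesis using t C(1) by (simp add: powr_minus powr_numeral field_simps)
  qed
  have "set_integrable lborel {a..} (\<lambda>t. t powr (- 2))"
    unfolding set_integrable_def
  proof (rule integrable_completion[THEN iffD1])
    show "integrable lebesgue (\<lambda>x. indicator {a..} x *\<^sub>R x powr (- 2))"
      using nonnegative_absolutely_integrable_1[OF has_integral_integrable[OF has_integral_powr_to_inf[of "-2" a]]] a
      by (simp add: set_integrable_def)
  qed auto
  hence "set_integrable lborel {a..} (\<lambda>t. C * t powr (- 2))"
    by (intro set_integrable_mult_right) auto
  thus ?thesis
  proof (rule set_integrable_bound)
    show "set_borel_measurable lborel {a..} real_Xi"
      using borel_measurable_continuous_onI[OF continuous_on_real_Xi]
      unfolding set_borel_measurable_def by simp
  qed (use bound in auto)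
qed

text \<open>
  Integrability is essential: the Bochner integral of a non-integrable function is \<open>0\<close>, so
  without it the three integrals would be unrelated.
\<close>

lemma set_integral_pos_neg_parts:
  fixes f :: "'a \<Rightarrow> real"
  assumes f: "set_integrable M A f" and A: "A \<in> sets M" and meas: "f \<in> borel_measurable M"
  shows "(LINT t:A|M. f t) =
    (LINT t:{t \<in> A. f t > 0}|M. f t) + (LINT t:{t \<in> A. f t < 0}|M. f t)"
proof -
  have sub: "A \<subseteq> space M" using A by (rule sets.sets_into_space)
  have "{t \<in> space M. f t > 0} \<inter> A \<in> sets M" "{t \<in> space M. f t < 0} \<inter> A \<in> sets M"
    using meas A by measurable
  moreover have "{t \<in> space M. f t > 0} \<inter> A = {t \<in> A. f t > 0}"
    "{t \<in> space M. f t < 0} \<inter> A = {t \<in> A. f t < 0}" using sub by auto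
  ultimately have m: "{t \<in> A. f t > 0} \<in> sets M" "{t \<in> A. f t < 0} \<in> sets M" by simp_all
  have i: "set_integrable M {t \<in> A. f t > 0} f" "set_integrable M {t \<in> A. f t < 0} f"
    using m by (auto intro: set_integrable_subset[OF f])
  have "(LINT t:A|M. f t) = (LINT t:{t \<in> A. f t > 0} \<union> {t \<in> A. f t < 0}|M. f t)"
    unfolding set_lebesgue_integral_def
    by (rule Bochner_Integration.integral_cong) (auto simp: indicator_def)
  also have "\<dots> = (LINT t:{t \<in> A. f t > 0}|M. f t) + (LINT t:{t \<in> A. f t < 0}|M. f t)"
    by (rule set_integral_Un[OF _ i]) auto
  finally show ?thesis .
qed

theorem corollary1:
  fixes \<epsilon> :: real and \<omega> :: "nat \<Rightarrow> real"
  assumes "\<epsilon> > 0"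
    and "mono_on {1..} \<omega>"
    and "\<And>n. n \<ge> 1 \<Longrightarrow> \<omega> n > 0"
    and "\<And>n. n \<ge> 1 \<Longrightarrow> (LINT t:{\<omega> n..}|lborel. real_Xi t) = 0"
    and "\<And>n. n \<ge> 1 \<Longrightarrow> \<omega> (n + 1) - \<omega> n < \<omega> n powr (1 / 6 + \<epsilon>)"
  shows "\<forall>n\<ge>1. (LINT t:{t \<in> {\<omega> n..}. real_Xi t > 0}|lborel. real_Xi t) =
               - (LINT t:{t \<in> {\<omega> n..}. real_Xi t < 0}|lborel. real_Xi t)"
proof (intro allI impI)
  fix n :: nat assume n: "n \<ge> 1"
  have meas: "real_Xi \<in> borel_measurable lborel"
    using borel_measurable_continuous_onI[OF continuous_on_real_Xi] by simp
  show "(LINT t:{t \<in> {\<omega> n..}. real_Xi t > 0}|lborel. real_Xi t) =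
               - (LINT t:{t \<in> {\<omega> n..}. real_Xi t < 0}|lborel. real_Xi t)"
    using set_integral_pos_neg_parts[OF set_integrable_real_Xi[OF assms(3)[OF n]] _ meas]
      assms(4)[OF n] by simp
qed

end
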